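(* There exist (i) an $\mathit{LTL}^{\bigcirc}_{\mathit{horn}}$ ontology-mediated atomic query (OMAQ), and (ii) an $\mathit{LTL}^{\Box}_{\mathit{krom}}$ and an $\mathit{LTL}^{\bigcirc}_{\mathit{krom}}$ ontology-mediated positive instance query (OMPIQ), for each of which the answering problem is $\mathrm{NC}^1$-hard for data complexity.
   Context: Fix a countably infinite set of atomic concepts. Temporal concepts (LTL-formulas) are given by $\varkappa::=\top\mid A_i\mid\neg\varkappa\mid\varkappa_1\land\varkappa_2\mid\varkappa_1\lor\varkappa_2\mid\bigcirc_F\varkappa\mid\Diamond_F\varkappa\mid\Box_F\varkappa\mid\varkappa_1\,\mathcal U\,\varkappa_2\mid\bigcirc_P\varkappa\mid\Diamond_P\varkappa\mid\Box_P\varkappa\mid\varkappa_1\,\mathcal S\,\varkappa_2$; a positive temporal concept is one without $\neg$. An interpretation $\mathfrak M$ assigns to each atomic concept $A$ a set $A^{\mathfrak M}\subseteq\mathbb Z$. Extensions: $\top^{\mathfrak M}=\mathbb Z$, Booleans set-theoretically, $(\bigcirc_F\varkappa)^{\mathfrak M}=\{n\mid n+1\in\varkappa^{\mathfrak M}\}$, $(\Box_F\varkappa)^{\mathfrak M}=\{n\mid k\in\varkappa^{\mathfrak M}\ \forall k>n\}$, $(\Diamond_F\varkappa)^{\mathfrak M}=\{n\mid\exists k>n,\ k\in\varkappa^{\mathfrak M}\}$, $(\varkappa_1\,\mathcal U\,\varkappa_2)^{\mathfrak M}=\{n\mid\exists k>n,\ k\in\varkappa_2^{\mathfrak M}\text{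 and }m\in\varkappa_1^{\mathfrak M}\text{ for all }n<m<k\}$, and symmetrically for the past operators. An ontology $\mathcal O$ is a finite set of clauses $C_1\land\dots\land C_k\to C_{k+1}\lor\dots\lor C_{k+m}$, $k,m\ge0$ (empty $\land$ is $\top$, empty $\lor$ is $\bot$), where each $C_i$ is an atomic concept prefixed by a sequence of operators from $\Box_F,\Box_P,\bigcirc_F,\bigcirc_P$. It is an $\mathit{LTL}^{\boldsymbol o}_{\boldsymbol c}$ ontology, $\boldsymbol o\in\{\Box,\bigcirc\}$, if only the (future and past) operators of the kind $\boldsymbol o$ occur in it and every clause satisfies $m\le1$ when $\boldsymbol c=\mathit{horn}$, and $k+m\le2$ when $\boldsymbol c=\mathit{krom}$. A clause is true in $\mathfrak M$ if $\bigcap_{i\le k}C_i^{\mathfrak M}\subseteq\bigcup_{j=1}^{m}C_{k+j}^{\mathfrak M}$ (empty $\bigcap$ is $\mathbb Z$, empty $\bigcup$ is $\emptyset$). An $\mathit{LTL}^{\boldsymbol o}_{\boldsymbol c}$ OMPIQ is a pair $\boldsymbol q=(\mathcal O,\varkappa)$ with an $\mathit{LTL}^{\boldsymbol o}_{\boldsymbol c}$ ontology $\mathcal O$ and a positive temporal concept $\varkappa$ (which may use arbitrary temporal operators); it is an OMAQ if $\varkappa$ is an atomic concept. A data instance $\mathcal A$ is a finite set of ground atoms $A_i(\ell)$, $\ell\in\mathbb Z$; it is assumed throughout that the least integer $\min\mathcal A$ occurring in it is $0$ and the greatest one satisfies $\max\mathcal A\ge1$; $\mathrm{tem}(\mathcal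 A)=\{n\in\mathbb Z\mid\min\mathcal A\le n\le\max\mathcal A\}$. $\mathfrak M$ is a model of $(\mathcal O,\mathcal A)$ if all clauses of $\mathcal O$ are true in $\mathfrak M$ and $\ell\in A^{\mathfrak M}$ for all $A(\ell)\in\mathcal A$. $\mathrm{ans}(\boldsymbol q,\mathcal A)=\{\ell\in\mathrm{tem}(\mathcal A)\mid\ell\in\varkappa^{\mathfrak M}\text{ for every model }\mathfrak M\text{ of }(\mathcal O,\mathcal A)\}$. The answering problem for $\boldsymbol q$ in data complexity: $\boldsymbol q$ is fixed; given a data instance $\mathcal A$ (timestamps in unary) and $\ell\in\mathrm{tem}(\mathcal A)$, decide whether $\ell\in\mathrm{ans}(\boldsymbol q,\mathcal A)$. $\mathrm{NC}^1$-hardness is understood with respect to the usual reductions for this class (e.g. $\mathrm{AC}^0$ many-one reductions). *)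

theory Defs
  imports Complex_Main "HOL-Library.Landau_Symbols"
begin

section \<open>Temporal concepts\<close>

type_synonym atom = nat

datatype concept =
    Top
  | Atom atom
  | Neg concept
  | Conj concept concept
  | Disj concept concept
  | NextF concept
  | DiaF concept
  | BoxF concept
  | Until concept concept
  | NextP concept
  | DiaP concept
  | BoxP concept
  | Since concept concept

primrec positive :: "concept \<Rightarrow> bool" where
  "positive Top = True"
| "positive (Atom A) = True"
| "positive (Neg c) = False"
| "positive (Conj c d) = (positive c \<and> positive d)"
| "positive (Disj c d) = (positive c \<and> positive d)"
| "positive (NextF c) = positive c"
| "positive (DiaF c) = positive c"
| "positive (BoxF c) = positive c"
| "positive (Until c d) = (positive c \<and> positive d)"
| "positive (NextP c) = positive c"
| "positive (DiaP c) = positive c"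
| "positive (BoxP c) = positive c"
| "positive (Since c d) = (positive c \<and> positive d)"

type_synonym interp = "atom \<Rightarrow> int set"

text \<open>All operators except \<open>NextF\<close> and \<open>NextP\<close> have the strict reading: the current
  moment is not included.\<close>

primrec ext :: "interp \<Rightarrow> concept \<Rightarrow> int set" where
  "ext M Top = UNIV"
| "ext M (Atom A) = M A"
| "ext M (Neg c) = - ext M c"
| "ext M (Conj c d) = ext M c \<inter> ext M d"
| "ext M (Disj c d) = ext M c \<union> ext M d"
| "ext M (NextF c) = {n. n + 1 \<in> ext M c}"
| "ext M (DiaF c) = {n. \<exists>k>n. k \<in> ext M c}"
| "ext M (BoxF c) = {n. \<forall>k>n. k \<in> ext M c}"
| "ext M (Until c d) = {n. \<exists>k>n. k \<in> ext M d \<and> (\<forall>m. n < m \<and> m < k \<longrightarrow> m \<in> ext M c)}"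
| "ext M (NextP c) = {n. n - 1 \<in> ext M c}"
| "ext M (DiaP c) = {n. \<exists>k<n. k \<in> ext M c}"
| "ext M (BoxP c) = {n. \<forall>k<n. k \<in> ext M c}"
| "ext M (Since c d) = {n. \<exists>k<n. k \<in> ext M d \<and> (\<forall>m. k < m \<and> m < n \<longrightarrow> m \<in> ext M c)}"

section \<open>Ontologies and queries\<close>

datatype oper = OpBoxF | OpBoxP | OpNextF | OpNextP

primrec apply_op :: "oper \<Rightarrow> concept \<Rightarrow> concept" where
  "apply_op OpBoxF = BoxF"
| "apply_op OpBoxP = BoxP"
| "apply_op OpNextF = NextF"
| "apply_op OpNextP = NextP"

text \<open>\<open>([o\<^sub>1, \<dots>, o\<^sub>r], A)\<close> stands for the concept \<open>o\<^sub>1 \<dots> o\<^sub>r A\<close>.\<close>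

type_synonym basic = "oper list \<times> atom"

definition basic_concept :: "basic \<Rightarrow> concept" where
  "basic_concept C = foldr apply_op (fst C) (Atom (snd C))"

text \<open>\<open>([C\<^sub>1, \<dots>, C\<^sub>k], [D\<^sub>1, \<dots>, D\<^sub>m])\<close> stands for the clause
  \<open>C\<^sub>1 \<and> \<dots> \<and> C\<^sub>k \<rightarrow> D\<^sub>1 \<or> \<dots> \<or> D\<^sub>m\<close>.\<close>

type_synonym clause = "basic list \<times> basic list"

definition clause_true :: "interp \<Rightarrow> clause \<Rightarrow> bool" where
  "clause_true M cl \<longleftrightarrow>
     (\<Inter>C\<in>set (fst cl). ext M (basic_concept C)) \<subseteq> (\<Union>C\<in>set (snd cl). ext M (basic_concept C))"

datatype op_kind = Box | Next
datatype clause_kind = Horn | Krom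

primrec ops_of_kind :: "op_kind \<Rightarrow> oper set" where
  "ops_of_kind Box = {OpBoxF, OpBoxP}"
| "ops_of_kind Next = {OpNextF, OpNextP}"

primrec clause_of_kind :: "clause_kind \<Rightarrow> clause \<Rightarrow> bool" where
  "clause_of_kind Horn cl = (length (snd cl) \<le> 1)"
| "clause_of_kind Krom cl = (length (fst cl) + length (snd cl) \<le> 2)"

type_synonym ontology = "clause set"

definition is_ontology :: "op_kind \<Rightarrow> clause_kind \<Rightarrow> ontology \<Rightarrow> bool" where
  "is_ontology ok ck T \<longleftrightarrow> finite T \<and>
     (\<forall>cl\<in>T. clause_of_kind ck cl \<and>
       (\<forall>C\<in>set (fst cl) \<union> set (snd cl). set (fst C) \<subseteq> ops_of_kind ok))"

type_synonym omq = "ontology \<times> concept"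

definition is_OMPIQ :: "op_kind \<Rightarrow> clause_kind \<Rightarrow> omq \<Rightarrow> bool" where
  "is_OMPIQ ok ck q \<longleftrightarrow> is_ontology ok ck (fst q) \<and> positive (snd q)"

definition is_OMAQ :: "op_kind \<Rightarrow> clause_kind \<Rightarrow> omq \<Rightarrow> bool" where
  "is_OMAQ ok ck q \<longleftrightarrow> is_OMPIQ ok ck q \<and> (\<exists>A. snd q = Atom A)"

section \<open>Data instances and certain answers\<close>

type_synonym data = "(atom \<times> int) set"

definition is_data :: "data \<Rightarrow> bool" where
  "is_data D \<longleftrightarrow> finite D \<and> D \<noteq> {} \<and> Min (snd ` D) = 0 \<and> Max (snd ` D) \<ge> 1"

definition tem :: "data \<Rightarrow> int set" where
  "tem D = {Min (snd ` D)..Max (snd ` D)}"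

definition is_model :: "ontology \<Rightarrow> data \<Rightarrow> interp \<Rightarrow> bool" where
  "is_model T D M \<longleftrightarrow> (\<forall>cl\<in>T. clause_true M cl) \<and> (\<forall>(A, l)\<in>D. l \<in> M A)"

definition ans :: "omq \<Rightarrow> data \<Rightarrow> int set" where
  "ans q D = {l \<in> tem D. \<forall>M. is_model (fst q) D M \<longrightarrow> l \<in> ext M (snd q)}"

text \<open>An input of the answering problem consists of a timestamp and a list of ground atoms, all
  numbers being written in unary. Every listing of a data instance is an admissible input.
  Timestamps of data instances are nonnegative, so no information is lost by \<open>nat\<close>.\<close>

definition unary :: "nat \<Rightarrow> bool list" where
  "unary n = replicate n True @ [False]"

definition encode :: "(atom \<times> int) list \<Rightarrow> int \<Rightarrow> bool list" where
  "encode D l = unary (nat l) @ concat (map (\<lambda>(A, t). unary A @ unary (nat t)) D)"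

definition answering_problem :: "omq \<Rightarrow> bool list set" where
  "answering_problem q = {encode D l | D l. is_data (set D) \<and> l \<in> ans q (set D)}"

section \<open>Boolean circuits\<close>

text \<open>A circuit is a topologically sorted list of gates; arguments of gates and outputs
  are positions in this list. Conjunctions and disjunctions of no arguments are constants.\<close>

datatype gate = Input nat | NotG nat | AndG "nat list" | OrG "nat list"

primrec args :: "gate \<Rightarrow> nat list" where
  "args (Input i) = []"
| "args (NotG j) = [j]"
| "args (AndG js) = js"
| "args (OrG js) = js"

record circuit =
  gates :: "gate list"
  outputs :: "nat list"

definition wf_circuit :: "nat \<Rightarrow> circuit \<Rightarrow> bool" where
  "wf_circuit n C \<longleftrightarrow>
     (\<forall>i. Input i \<in> set (gates C) \<longrightarrow> i < n) \<and>
     (\<forall>k<length (gates C). \<forall>j\<in>set (args (gates C ! k)). j < k) \<and>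
     (\<forall>j\<in>set (outputs C). j < length (gates C))"

primrec gate_value :: "bool list \<Rightarrow> bool list \<Rightarrow> gate \<Rightarrow> bool" where
  "gate_value x vs (Input i) = x ! i"
| "gate_value x vs (NotG j) = (\<not> vs ! j)"
| "gate_value x vs (AndG js) = (\<forall>j\<in>set js. vs ! j)"
| "gate_value x vs (OrG js) = (\<exists>j\<in>set js. vs ! j)"

definition gate_values :: "bool list \<Rightarrow> circuit \<Rightarrow> bool list" where
  "gate_values x C = foldl (\<lambda>vs g. vs @ [gate_value x vs g]) [] (gates C)"

definition circuit_eval :: "circuit \<Rightarrow> bool list \<Rightarrow> bool list" where
  "circuit_eval C x = map ((!) (gate_values x C)) (outputs C)"

primrec gate_depth :: "nat list \<Rightarrow> gate \<Rightarrow> nat" where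
  "gate_depth ds (Input i) = 0"
| "gate_depth ds (NotG j) = Suc (ds ! j)"
| "gate_depth ds (AndG js) = Suc (Max (insert 0 ((!) ds ` set js)))"
| "gate_depth ds (OrG js) = Suc (Max (insert 0 ((!) ds ` set js)))"

definition gate_depths :: "circuit \<Rightarrow> nat list" where
  "gate_depths C = foldl (\<lambda>ds g. ds @ [gate_depth ds g]) [] (gates C)"

definition circuit_depth :: "circuit \<Rightarrow> nat" where
  "circuit_depth C = Max (insert 0 (set (gate_depths C)))"

text \<open>Output positions are counted as well, since a gate may be output repeatedly.\<close>

definition circuit_size :: "circuit \<Rightarrow> nat" where
  "circuit_size C = length (gates C) + length (outputs C)"

definition bounded_fanin :: "circuit \<Rightarrow> bool" where
  "bounded_fanin C \<longleftrightarrow> (\<forall>g\<in>set (gates C). length (args g) \<le> 2)"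

definition poly_size :: "(nat \<Rightarrow> circuit) \<Rightarrow> bool" where
  "poly_size C \<longleftrightarrow> (\<exists>k::nat. (\<lambda>n. real (circuit_size (C n))) \<in> O(\<lambda>n. real n ^ k))"

section \<open>The class and its reductions\<close>

text \<open>Both the class and the reductions are non-uniform.\<close>

definition NC1 :: "bool list set set" where
  "NC1 = {L. \<exists>C :: nat \<Rightarrow> circuit.
     (\<forall>n. wf_circuit n (C n) \<and> bounded_fanin (C n)) \<and>
     poly_size C \<and>
     (\<lambda>n. real (circuit_depth (C n))) \<in> O(\<lambda>n. log 2 (real n)) \<and>
     (\<forall>x. circuit_eval (C (length x)) x = [x \<in> L])}"

definition AC0_computable :: "(bool list \<Rightarrow> bool list) \<Rightarrow> bool" where
  "AC0_computable f \<longleftrightarrow> (\<exists>C :: nat \<Rightarrow> circuit.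
     (\<forall>n. wf_circuit n (C n)) \<and>
     poly_size C \<and>
     (\<lambda>n. real (circuit_depth (C n))) \<in> O(\<lambda>n. 1) \<and>
     (\<forall>x. circuit_eval (C (length x)) x = f x))"

definition AC0_reducible :: "bool list set \<Rightarrow> bool list set \<Rightarrow> bool" where
  "AC0_reducible L L' \<longleftrightarrow> (\<exists>f. AC0_computable f \<and> (\<forall>x. x \<in> L \<longleftrightarrow> f x \<in> L'))"

definition NC1_hard :: "bool list set \<Rightarrow> bool" where
  "NC1_hard L' \<longleftrightarrow> (\<forall>L\<in>NC1. AC0_reducible L L')"

end

theory Submission
  imports Defs
begin

text \<open>Following Barrington, a gate of depth \<open>d\<close> is turned into a sequence of exponential length in
  \<open>d\<close> of permutations of five points, each selected by one input bit, whose product is a given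
  5-cycle if the gate is true and the identity otherwise: the conjunction of two gates is a
  commutator. So a language in \<open>NC\<^sup>1\<close> is reduced by a projection to the word problem of
  an automaton with five states. In an \<open>LTL\<close> Horn ontology, the run of this automaton is described by
  \<open>S\<^sub>s \<and> a \<rightarrow> \<circle>\<^sub>F S\<^bsub>a(s)\<^esub>\<close>. A Krom ontology without temporal operators can
  guess the run by \<open>\<top> \<rightarrow> S\<^sub>s \<or> S'\<^sub>s\<close>, where \<open>S'\<^sub>s\<close> is meant as the complement of \<open>S\<^sub>s\<close>,
  and the positive query asks whether the final state is accepting or some step
  \<open>S\<^sub>s \<and> a \<and> \<circle>\<^sub>F S'\<^bsub>a(s)\<^esub>\<close> of the guess is wrong.\<close>

section \<open>Projections are computable in constant depth\<close>

text \<open>The value type is arbitrary, so that the notion covers output bits as well as whole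
  letters selected by one input bit; it is then stable under composition with any function.\<close>

definition projection :: "nat \<Rightarrow> (bool list \<Rightarrow> 'a) \<Rightarrow> bool" where
  "projection n h \<longleftrightarrow>
     (\<exists>c. h = (\<lambda>_. c)) \<or> (\<exists>i<n. \<exists>a b. h = (\<lambda>x. if x ! i then a else b))"

text \<open>The list \<open>H\<close> is fixed before the input, so the output length is the same
  for all inputs, as it must be for the output list of a circuit.\<close>

definition projections :: "nat \<Rightarrow> (bool list \<Rightarrow> 'a list) \<Rightarrow> bool" where
  "projections n F \<longleftrightarrow> (\<exists>H. (\<forall>h\<in>set H. projection n h) \<and> F = (\<lambda>x. map (\<lambda>h. h x) H))"

lemma projection_const: "projection n (\<lambda>_. c)"
  unfolding projection_def by blast

lemma projection_comp:
  assumes "projection n h"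
  shows "projection n (\<lambda>x. g (h x))"
proof -
  consider c where "h = (\<lambda>_. c)" | i a b where "i < n" "h = (\<lambda>x. if x ! i then a else b)"
    using assms unfolding projection_def by blast
  then show ?thesis
  proof cases
    case 1
    then show ?thesis by (simp add: projection_const)
  next
    case 2
    then have "(\<lambda>x. g (h x)) = (\<lambda>x. if x ! i then g a else g b)"
      by auto
    with 2(1) show ?thesis unfolding projection_def by blast
  qed
qed

lemma projections_const: "projections n (\<lambda>_. c)"
  unfolding projections_def
  by (intro exI[of _ "map (\<lambda>b _. b) c"]) (auto simp: projection_const o_def)

lemma projections_append:
  assumes "projections n F" "projections n G"
  shows "projections n (\<lambda>x. F x @ G x)"
proof -
  obtain H K where "\<forall>h\<in>set H. projection n h" "F = (\<lambda>x. map (\<lambda>h. h x) H)"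
    "\<forall>h\<in>set K. projection n h" "G = (\<lambda>x. map (\<lambda>h. h x) K)"
    using assms unfolding projections_def by blast
  then show ?thesis
    unfolding projections_def by (intro exI[of _ "H @ K"]) auto
qed

lemma projections_concat:
  assumes "\<And>t. t \<in> set ts \<Longrightarrow> projections n (F t)"
  shows "projections n (\<lambda>x. concat (map (\<lambda>t. F t x) ts))"
  using assms
proof (induction ts)
  case Nil
  then show ?case by (simp add: projections_const)
next
  case (Cons t ts)
  then show ?case by (simp add: projections_append)
qed

text \<open>A block of bits determined by one projection splits into single bits, each again a
  projection. The fixed length \<open>l\<close> is what allows a split independent of the
  input.\<close>

lemma projections_comp:
  assumes "projection n h" "\<And>x. length (g (h x)) = l"
  shows "projections n (\<lambda>x. g (h x))"
proof -
  have "(\<lambda>x. g (h x)) = (\<lambda>x. map (\<lambda>f. f x) (map (\<lambda>j x. g (h x) ! j) [0..<l]))"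
    using assms(2) by (auto intro!: nth_equalityI)
  moreover have "\<forall>f\<in>set (map (\<lambda>j x. g (h x) ! j) [0..<l]). projection n f"
    using projection_comp[OF assms(1), where g = "\<lambda>a. g a ! _"] by auto
  ultimately show ?thesis unfolding projections_def by blast
qed

section \<open>Circuit evaluation and depth as recursions over gate positions\<close>

lemma foldl_snoc:
  "length (foldl (\<lambda>vs g. vs @ [F vs g]) [] gs) = length gs \<and>
   (\<forall>k<length gs. foldl (\<lambda>vs g. vs @ [F vs g]) [] gs ! k =
     F (take k (foldl (\<lambda>vs g. vs @ [F vs g]) [] gs)) (gs ! k))"
proof (induction gs rule: rev_induct)
  case Nil
  then show ?case by simp
next
  case (snoc g gs)
  then show ?case by (auto simp: nth_append less_Suc_eq)
qed

lemma length_gate_depths: "length (gate_depths C) = length (gates C)"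
  unfolding gate_depths_def using foldl_snoc by blast

lemma gate_value_take:
  assumes "\<forall>j\<in>set (args g). j < k"
  shows "gate_value x (take k vs) g = gate_value x vs g"
  using assms by (cases g) auto

lemma gate_depth_take:
  assumes "\<forall>j\<in>set (args g). j < k"
  shows "gate_depth (take k ds) g = gate_depth ds g"
proof -
  have "(!) (take k ds) ` set js = (!) ds ` set js" if "\<forall>j\<in>set js. j < k" for js
    using that by (intro image_cong) auto
  then show ?thesis using assms by (cases g) auto
qed

text \<open>In a well-formed circuit all arguments of gate \<open>k\<close> lie before
  \<open>k\<close>, so the prefix that the fold has built so far may be replaced by the final list
  of values.\<close>

lemma gate_values_nth:
  assumes "wf_circuit n C" "k < length (gates C)"
  shows "gate_values x C ! k = gate_value x (gate_values x C) (gates C ! k)"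
proof -
  have "gate_values x C ! k = gate_value x (take k (gate_values x C)) (gates C ! k)"
    unfolding gate_values_def using foldl_snoc assms(2) by blast
  moreover have "\<forall>j\<in>set (args (gates C ! k)). j < k"
    using assms unfolding wf_circuit_def by blast
  ultimately show ?thesis by (simp add: gate_value_take)
qed

lemma gate_depths_nth:
  assumes "wf_circuit n C" "k < length (gates C)"
  shows "gate_depths C ! k = gate_depth (gate_depths C) (gates C ! k)"
proof -
  have "gate_depths C ! k = gate_depth (take k (gate_depths C)) (gates C ! k)"
    unfolding gate_depths_def using foldl_snoc assms(2) by blast
  moreover have "\<forall>j\<in>set (args (gates C ! k)). j < k"
    using assms unfolding wf_circuit_def by blast
  ultimately show ?thesis by (simp add: gate_depth_take)
qed

text \<open>The order is: true, false, the \<open>n\<close> inputs, their \<open>n\<close>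
  negations. These are all the Boolean projections, so a function given by projections is computed
  by a mere choice of output positions.\<close>

definition literal_gates :: "nat \<Rightarrow> gate list" where
  "literal_gates n = [AndG [], OrG []] @ map Input [0..<n] @ map (\<lambda>i. NotG (Suc (Suc i))) [0..<n]"

lemma length_literal_gates: "length (literal_gates n) = 2 * n + 2"
  by (simp add: literal_gates_def)

lemma literal_gates_nth:
  "literal_gates n ! 0 = AndG []"
  "literal_gates n ! Suc 0 = OrG []"
  "i < n \<Longrightarrow> literal_gates n ! (Suc (Suc i)) = Input i"
  "i < n \<Longrightarrow> literal_gates n ! (Suc (Suc (n + i))) = NotG (Suc (Suc i))"
  by (auto simp: literal_gates_def nth_append)

lemma literal_gates_cases:
  assumes "k < length (literal_gates n)"
  obtains "k = 0" | "k = Suc 0" | i where "i < n" "k = Suc (Suc i)" | i where "i < n" "k = Suc (Suc (n + i))"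
proof -
  have "k = 0 \<or> k = Suc 0 \<or> k - 2 < n \<and> k = Suc (Suc (k - 2)) \<or>
      k - 2 - n < n \<and> k = Suc (Suc (n + (k - 2 - n)))"
    using assms by (auto simp: length_literal_gates)
  then show ?thesis using that by blast
qed

lemma wf_literal_circuit:
  assumes "\<forall>p\<in>set ps. p < length (literal_gates n)"
  shows "wf_circuit n \<lparr>gates = literal_gates n, outputs = ps\<rparr>"
proof -
  have "\<forall>k<length (literal_gates n). \<forall>j\<in>set (args (literal_gates n ! k)). j < k"
  proof (intro allI impI)
    fix k assume "k < length (literal_gates n)"
    then show "\<forall>j\<in>set (args (literal_gates n ! k)). j < k"
      by (cases rule: literal_gates_cases) (auto simp: literal_gates_nth)
  qed
  then show ?thesis
    using assms unfolding wf_circuit_def by (auto simp: literal_gates_def)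
qed

text \<open>Constants are gates without arguments, of depth 1, and negations are applied to inputs
  only, which have depth 0.\<close>

lemma literal_circuit_depth:
  assumes "wf_circuit n \<lparr>gates = literal_gates n, outputs = ps\<rparr>"
  shows "circuit_depth \<lparr>gates = literal_gates n, outputs = ps\<rparr> \<le> 1"
proof -
  let ?C = "\<lparr>gates = literal_gates n, outputs = ps\<rparr>"
  have nth: "gate_depths ?C ! k = gate_depth (gate_depths ?C) (literal_gates n ! k)"
    if "k < length (literal_gates n)" for k
    using gate_depths_nth[OF assms] that by simp
  have inp: "gate_depths ?C ! (Suc (Suc i)) = 0" if "i < n" for i
    using nth[of "Suc (Suc i)"] that by (simp add: length_literal_gates literal_gates_nth)
  have "gate_depths ?C ! k \<le> 1" if "k < length (literal_gates n)" for k
    using that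
  proof (cases rule: literal_gates_cases)
    case (4 i)
    then show ?thesis
      using nth[OF that] inp[of i] by (simp add: literal_gates_nth)
  qed (use nth[OF that] in \<open>auto simp: literal_gates_nth\<close>)
  then show ?thesis
    unfolding circuit_depth_def
    by (auto simp: in_set_conv_nth length_gate_depths)
qed

text \<open>The position \<open>p\<close> is chosen before the outputs \<open>ps\<close>, because
  the output list is later assembled from such positions.\<close>

lemma literal_gates_projection:
  fixes h :: "bool list \<Rightarrow> bool"
  assumes "projection n h"
  shows "\<exists>p<length (literal_gates n). \<forall>x ps.
    wf_circuit n \<lparr>gates = literal_gates n, outputs = ps\<rparr> \<longrightarrow>
    gate_values x \<lparr>gates = literal_gates n, outputs = ps\<rparr> ! p = h x"
proof -
  have nth: "gate_values x \<lparr>gates = literal_gates n, outputs = ps\<rparr> ! k =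
      gate_value x (gate_values x \<lparr>gates = literal_gates n, outputs = ps\<rparr>) (literal_gates n ! k)"
    if "wf_circuit n \<lparr>gates = literal_gates n, outputs = ps\<rparr>" "k < 2 * n + 2" for x ps k
    using gate_values_nth[OF that(1), of k x] that(2) by (simp add: length_literal_gates)
  have const: ?thesis if "h = (\<lambda>_. c)" for c
    by (rule exI[of _ "if c then 0 else 1"])
      (auto simp: that length_literal_gates nth literal_gates_nth)
  consider c where "h = (\<lambda>_. c)" | i a b where "i < n" "h = (\<lambda>x. if x ! i then a else b)"
    using assms unfolding projection_def by blast
  then show ?thesis
  proof cases
    case 1
    then show ?thesis by (rule const)
  next
    case 2
    show ?thesis
    proof (cases "a = b")
      case True
      then show ?thesis using 2 const by simp
    next
      case False
      \<comment> \<open>Two different Boolean values leave only the input bit itself or its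
        negation.\<close>
      then have h: "h = (\<lambda>x. if a then x ! i else \<not> x ! i)"
        using 2 by auto
      show ?thesis
        by (rule exI[of _ "if a then Suc (Suc i) else Suc (Suc (n + i))"])
          (use \<open>i < n\<close> in \<open>auto simp: h length_literal_gates nth literal_gates_nth\<close>)
    qed
  qed
qed

text \<open>One literal gate is output for each bit of the result, so the size is linear in
  \<open>n\<close> plus the output length, and the depth is at most 1.\<close>

lemma AC0_computable_projections:
  assumes proj: "\<And>n. projections n (F n)"
    and f: "\<And>x. f x = F (length x) x"
    and poly: "\<And>n x. N \<le> n \<Longrightarrow> length (F n x) \<le> c * n ^ k"
  shows "AC0_computable f"
proof -
  have "\<forall>n. \<exists>ps. (\<forall>p\<in>set ps. p < length (literal_gates n)) \<and>
      (\<forall>x. circuit_eval \<lparr>gates = literal_gates n, outputs = ps\<rparr> x = F n x)"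
  proof
    fix n
    obtain H where H: "\<forall>h\<in>set H. projection n h" "F n = (\<lambda>x. map (\<lambda>h. h x) H)"
      using proj[of n] unfolding projections_def by blast
    obtain pos where pos: "\<And>h. h \<in> set H \<Longrightarrow> pos h < length (literal_gates n)"
      "\<And>h x ps. h \<in> set H \<Longrightarrow> wf_circuit n \<lparr>gates = literal_gates n, outputs = ps\<rparr> \<Longrightarrow>
        gate_values x \<lparr>gates = literal_gates n, outputs = ps\<rparr> ! pos h = h x"
      using H(1) literal_gates_projection by metis
    have "\<forall>p\<in>set (map pos H). p < length (literal_gates n)"
      using pos(1) by auto
    moreover from wf_literal_circuit[OF this]
    have "circuit_eval \<lparr>gates = literal_gates n, outputs = map pos H\<rparr> x = F n x" for x
      unfolding circuit_eval_def H(2) using pos(2) by simp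
    ultimately show "\<exists>ps. (\<forall>p\<in>set ps. p < length (literal_gates n)) \<and>
      (\<forall>x. circuit_eval \<lparr>gates = literal_gates n, outputs = ps\<rparr> x = F n x)"
      by blast
  qed
  then obtain ps where ps: "\<And>n. \<forall>p\<in>set (ps n). p < length (literal_gates n)"
    "\<And>n x. circuit_eval \<lparr>gates = literal_gates n, outputs = ps n\<rparr> x = F n x"
    by metis
  let ?C = "\<lambda>n. \<lparr>gates = literal_gates n, outputs = ps n\<rparr>"
  have wf: "wf_circuit n (?C n)" for n
    using ps(1) by (rule wf_literal_circuit)
  \<comment> \<open>The exponent \<open>k + 1\<close> also absorbs the \<open>2 * n + 2\<close>
    gates when \<open>k = 0\<close>.\<close>
  have "(\<lambda>n. real (circuit_size (?C n))) \<in> O(\<lambda>n. real n ^ (k + 1))"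
  proof (rule bigoI[where c = "real (c + 4)"], rule eventually_sequentiallyI[where c = "max N 1"])
    fix n assume n: "max N 1 \<le> n"
    \<comment> \<open>The number of outputs does not depend on the input, so any string will do,
      here \<open>[]\<close>.\<close>
    have "length (ps n) = length (F n [])"
      using ps(2)[of n "[]"] by (auto simp: circuit_eval_def dest: arg_cong[where f = length])
    also have "\<dots> \<le> c * n ^ k"
      using poly n by simp
    also have "\<dots> \<le> c * n ^ (k + 1)"
      using n by simp
    finally have "length (ps n) \<le> c * n ^ (k + 1)" .
    moreover have "2 * n + 2 \<le> 4 * n ^ (k + 1)"
    proof -
      have "n ^ 1 \<le> n ^ (k + 1)"
        using n by (intro power_increasing) auto
      then show ?thesis using n by (simp del: power_Suc)
    qed
    ultimately have "circuit_size (?C n) \<le> (c + 4) * n ^ (k + 1)"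
      by (simp add: circuit_size_def length_literal_gates algebra_simps)
    then have "real (circuit_size (?C n)) \<le> real ((c + 4) * n ^ (k + 1))"
      by (rule of_nat_mono)
    then show "norm (real (circuit_size (?C n))) \<le> real (c + 4) * norm (real n ^ (k + 1))"
      by simp
  qed
  moreover have "(\<lambda>n. real (circuit_depth (?C n))) \<in> O(\<lambda>n. 1)"
    by (rule bigoI[where c = 1])
      (use literal_circuit_depth[OF wf] in \<open>auto intro!: always_eventually\<close>)
  moreover have "circuit_eval (?C (length x)) x = f x" for x
    using ps(2) f by simp
  ultimately show ?thesis
    unfolding AC0_computable_def poly_size_def using wf by (intro exI[of _ ?C]) blast
qed

section \<open>Encodings of inputs\<close>

lemma length_unary [simp]: "length (unary n) = Suc n"
  by (simp add: unary_def)

text \<open>The closing \<open>False\<close> makes \<open>unary\<close> a prefix code.\<close>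

lemma unary_append_eq: "unary a @ xs = unary b @ ys \<longleftrightarrow> a = b \<and> xs = ys"
proof (induction a arbitrary: b)
  case 0
  then show ?case by (cases b) (auto simp: unary_def)
next
  case (Suc a)
  then show ?case by (cases b) (auto simp: unary_def)
qed

text \<open>The encoding is a concatenation of words of a prefix code, hence uniquely decodable;
  nonnegativity keeps \<open>nat\<close> from identifying different timestamps.\<close>

lemma encode_eq_iff:
  assumes "\<And>A t. (A, t) \<in> set D \<Longrightarrow> 0 \<le> t" "\<And>A t. (A, t) \<in> set D' \<Longrightarrow> 0 \<le> t"
    and "0 \<le> l" "0 \<le> l'"
  shows "encode D l = encode D' l' \<longleftrightarrow> D = D' \<and> l = l'"
proof -
  let ?e = "\<lambda>(A, t). unary A @ unary (nat t)"
  have "concat (map ?e D) = concat (map ?e D') \<longleftrightarrow> D = D'"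
    using assms(1,2)
  proof (induction D arbitrary: D')
    case Nil
    then show ?case by (cases D') (auto simp: unary_def)
  next
    case (Cons p D)
    obtain A t where p: "p = (A, t)" by fastforce
    show ?case
    proof (cases D')
      case Nil
      then show ?thesis by (simp add: p unary_def)
    next
      case (Cons p' D'')
      obtain A' t' where p': "p' = (A', t')" by fastforce
      have "0 \<le> t" "0 \<le> t'"
        using Cons.prems[of A t] Cons.prems(2)[of A' t'] by (auto simp: p p' Cons)
      moreover have "concat (map ?e D) = concat (map ?e D'') \<longleftrightarrow> D = D''"
        using Cons.prems by (intro Cons.IH) (auto simp: Cons)
      ultimately show ?thesis
        by (auto simp: Cons p p' unary_append_eq eq_nat_nat_iff)
    qed
  qed
  then show ?thesis
    using assms(3,4) by (auto simp: encode_def unary_append_eq eq_nat_nat_iff)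
qed

lemma is_data_nonneg:
  assumes "is_data D" "(A, t) \<in> D"
  shows "0 \<le> t"
proof -
  have "Min (snd ` D) \<le> t"
    using assms by (intro Min_le) (force simp: is_data_def)+
  then show ?thesis using assms(1) by (simp add: is_data_def)
qed

text \<open>The problem only asks for some instance with the given code. Unique decodability shows
  that this instance is the intended one.\<close>

lemma encode_in_answering_problem:
  assumes "is_data (set D)" "l \<in> tem (set D)"
  shows "encode D l \<in> answering_problem q \<longleftrightarrow> l \<in> ans q (set D)"
proof
  assume "encode D l \<in> answering_problem q"
  then obtain D' l' where *: "encode D l = encode D' l'" "is_data (set D')" "l' \<in> ans q (set D')"
    unfolding answering_problem_def by blast
  have "0 \<le> l" "0 \<le> l'"
    using assms * by (auto simp: ans_def tem_def is_data_def)
  then have "D = D' \<and> l = l'"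
    using encode_eq_iff[of D D' l l'] *(1) is_data_nonneg[OF assms(1)] is_data_nonneg[OF *(2)]
    by blast
  with *(3) show "l \<in> ans q (set D)" by simp
next
  assume "l \<in> ans q (set D)"
  with assms(1) show "encode D l \<in> answering_problem q"
    unfolding answering_problem_def by blast
qed


section \<open>Simulating an automaton by a query\<close>

text \<open>The automaton has the states \<open>0, \<dots>, m - 1\<close>, the letters \<open>0, \<dots>, K - 1\<close>, the initial
  state \<open>0\<close> and the accepting state \<open>1\<close>.\<close>

locale automaton =
  fixes m K :: nat and \<delta> :: "nat \<Rightarrow> nat \<Rightarrow> nat"
  assumes m_gt_1: "1 < m"
    and \<delta>_less: "a < K \<Longrightarrow> s < m \<Longrightarrow> \<delta> a s < m"
begin

abbreviation run :: "nat list \<Rightarrow> nat \<Rightarrow> nat" where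
  "run w s \<equiv> fold \<delta> w s"

text \<open>The residue modulo 3 keeps the three families of atoms disjoint.\<close>

definition state_atom :: "nat \<Rightarrow> atom" where "state_atom s = 3 * s"
definition costate_atom :: "nat \<Rightarrow> atom" where "costate_atom s = 3 * s + 1"
definition letter_atom :: "nat \<Rightarrow> atom" where "letter_atom a = 3 * a + 2"

lemma atom_eq_simps [simp]:
  "state_atom s = state_atom s' \<longleftrightarrow> s = s'"
  "costate_atom s = costate_atom s' \<longleftrightarrow> s = s'"
  "letter_atom a = letter_atom a' \<longleftrightarrow> a = a'"
  "state_atom s \<noteq> costate_atom s'" "costate_atom s' \<noteq> state_atom s"
  "state_atom s \<noteq> letter_atom a" "letter_atom a \<noteq> state_atom s"
  "costate_atom s \<noteq> letter_atom a" "letter_atom a \<noteq> costate_atom s"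
  unfolding state_atom_def costate_atom_def letter_atom_def by presburger+

text \<open>The letter \<open>K\<close>, which is not read by the automaton, marks the end of the word. The padding
  letter \<open>2 * K - w ! t\<close> is not read either; it makes the length of the encoding independent of
  the letters of \<open>w\<close>.\<close>

definition word_data :: "nat list \<Rightarrow> (atom \<times> int) list" where
  "word_data w = [(state_atom 0, 0), (letter_atom K, int (length w))] @
     concat (map (\<lambda>t. [(letter_atom (w ! t), int t), (letter_atom (2 * K - w ! t), int t)])
       [0..<length w])"

lemma word_data_iff:
  "(A, l) \<in> set (word_data w) \<longleftrightarrow>
     A = state_atom 0 \<and> l = 0 \<or> A = letter_atom K \<and> l = int (length w) \<or>
     (\<exists>t<length w. l = int t \<and> (A = letter_atom (w ! t) \<or> A = letter_atom (2 * K - w ! t)))"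
  by (auto simp: word_data_def)

lemma word_data_times: "snd ` set (word_data w) = int ` {..length w}"
proof (intro equalityI subsetI)
  fix l assume "l \<in> snd ` set (word_data w)"
  then obtain A where "(A, l) \<in> set (word_data w)" by auto
  then show "l \<in> int ` {..length w}" by (auto simp: word_data_iff)
next
  fix l assume "l \<in> int ` {..length w}"
  then obtain t where "l = int t" "t = length w \<or> t < length w" by fastforce
  then have "(letter_atom K, l) \<in> set (word_data w) \<or> (letter_atom (w ! t), l) \<in> set (word_data w)"
    by (auto simp: word_data_iff)
  then show "l \<in> snd ` set (word_data w)" by force
qed

lemma tem_word_data: "tem (set (word_data w)) = {0..int (length w)}"
  and is_data_word_data: "w \<noteq> [] \<Longrightarrow> is_data (set (word_data w))"
proof -
  have *: "Min (snd ` set (word_data w)) = 0" "Max (snd ` set (word_data w)) = int (length w)"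
    by (auto simp: word_data_times intro!: Min_eqI Max_eqI)
  then show "tem (set (word_data w)) = {0..int (length w)}"
    by (simp add: tem_def)
  show "is_data (set (word_data w))" if "w \<noteq> []"
    using that * by (auto simp: is_data_def word_data_def Suc_le_eq)
qed

section \<open>The Horn and the Krom query\<close>

definition horn_query :: omq where
  "horn_query =
    ((\<lambda>(s, a). ([([], state_atom s), ([], letter_atom a)], [([OpNextF], state_atom (\<delta> a s))])) `
       ({..<m} \<times> {..<K}),
     Atom (state_atom 1))"

definition guess_ontology :: ontology where
  "guess_ontology = (\<lambda>s. ([], [([], state_atom s), ([], costate_atom s)])) ` {..<m}"

definition wrong_step :: "nat \<times> nat \<Rightarrow> concept" where
  "wrong_step = (\<lambda>(s, a). Conj (Conj (Atom (state_atom s)) (Atom (letter_atom a)))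
     (NextF (Atom (costate_atom (\<delta> a s)))))"

text \<open>The letter \<open>3 * K\<close> does not occur in the data; it stands for the empty disjunction, which
  is not a concept.\<close>

definition krom_query :: omq where
  "krom_query = (guess_ontology, Disj (Atom (state_atom 1))
     (DiaP (foldr Disj (map wrong_step (List.product [0..<m] [0..<K])) (Atom (letter_atom (3 * K))))))"

lemma is_OMAQ_horn_query: "is_OMAQ Next Horn horn_query"
  by (auto simp: is_OMAQ_def is_OMPIQ_def is_ontology_def horn_query_def)

lemma positive_foldr_Disj:
  "positive (foldr Disj cs d) \<longleftrightarrow> (\<forall>c\<in>set cs. positive c) \<and> positive d"
  by (induction cs) auto

lemma ext_foldr_Disj: "ext M (foldr Disj cs d) = (\<Union>c\<in>set cs. ext M c) \<union> ext M d"
  by (induction cs) auto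

text \<open>The kind \<open>ok\<close> is arbitrary because no operator is prefixed to an atom of
  the ontology; one query thus serves both Krom claims.\<close>

lemma is_OMPIQ_krom_query: "is_OMPIQ ok Krom krom_query"
  by (auto simp: is_OMPIQ_def is_ontology_def krom_query_def guess_ontology_def
      positive_foldr_Disj wrong_step_def)

text \<open>The intended model for both queries: states follow the run during the word and hold
  nowhere else, costates are their complements on all integers, and letters are exactly those of the
  data.\<close>

definition run_model :: "nat list \<Rightarrow> interp" where
  "run_model w A =
    {l. (\<exists>t\<le>length w. l = int t \<and> A = state_atom (run (take t w) 0)) \<or>
        (\<exists>s. A = costate_atom s \<and> \<not> (\<exists>t\<le>length w. l = int t \<and> s = run (take t w) 0)) \<or>
        (\<exists>a. A = letter_atom a \<and> (A, l) \<in> set (word_data w))}"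

lemma run_model_simps:
  "l \<in> run_model w (state_atom s) \<longleftrightarrow> (\<exists>t\<le>length w. l = int t \<and> s = run (take t w) 0)"
  "l \<in> run_model w (costate_atom s) \<longleftrightarrow> l \<notin> run_model w (state_atom s)"
  "l \<in> run_model w (letter_atom a) \<longleftrightarrow> (letter_atom a, l) \<in> set (word_data w)"
  by (auto simp: run_model_def)

lemma run_model_data:
  assumes "(A, l) \<in> set (word_data w)"
  shows "l \<in> run_model w A"
  using assms
  by (auto simp: word_data_iff run_model_simps)

lemma run_take_Suc: "t < length w \<Longrightarrow> run (take (Suc t) w) s = \<delta> (w ! t) (run (take t w) s)"
  by (simp add: take_Suc_conv_app_nth)

lemma run_less:
  assumes "\<forall>a\<in>set w. a < K" "s < m"
  shows "run w s < m"
  using assms by (induction w arbitrary: s) (auto simp: \<delta>_less)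

lemma run_model_step:
  assumes w: "\<forall>a\<in>set w. a < K" and "a < K"
    and "l \<in> run_model w (state_atom s)" "l \<in> run_model w (letter_atom a)"
  shows "l + 1 \<in> run_model w (state_atom (\<delta> a s))"
proof -
  obtain t where t: "t \<le> length w" "l = int t" "s = run (take t w) 0"
    using assms(3) by (auto simp: run_model_simps)
  have "t < length w \<and> a = w ! t"
  proof -
    \<comment> \<open>A padding letter exceeds \<open>K\<close> since \<open>w ! t' < K\<close>, and
      the end marker is \<open>K\<close> itself. So a letter below \<open>K\<close> is a letter of
      the word, read before its end.\<close>
    have "a \<noteq> 2 * K - w ! t'" if "t' < length w" for t'
    proof -
      have "w ! t' < K" using w that by simp
      with \<open>a < K\<close> show ?thesis by simp
    qed
    then show ?thesis
      using assms(4) \<open>a < K\<close> t by (auto simp: run_model_simps word_data_iff)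
  qed
  with t show ?thesis
    by (auto simp: run_model_simps run_take_Suc intro!: exI[of _ "Suc t"])
qed

lemma run_model_final:
  "int (length w) \<in> run_model w (state_atom s) \<longleftrightarrow> s = run w 0"
  by (auto simp: run_model_simps)

section \<open>Certain answers at the end of the word as acceptance\<close>

lemma horn_query_ans:
  assumes w: "\<forall>a\<in>set w. a < K"
  shows "int (length w) \<in> ans horn_query (set (word_data w)) \<longleftrightarrow> run w 0 = 1"
proof
  assume "int (length w) \<in> ans horn_query (set (word_data w))"
  moreover have "is_model (fst horn_query) (set (word_data w)) (run_model w)"
    using run_model_step[OF w] run_model_data
    by (auto simp: is_model_def horn_query_def clause_true_def basic_concept_def)
  ultimately have "int (length w) \<in> ext (run_model w) (snd horn_query)"
    by (auto simp: ans_def)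
  then show "run w 0 = 1"
    using run_model_final[of w 1] by (simp add: horn_query_def)
next
  assume acc: "run w 0 = 1"
  have "int (length w) \<in> M (state_atom 1)"
    if M: "is_model (fst horn_query) (set (word_data w)) M" for M
  proof -
    have data: "l \<in> M A" if "(A, l) \<in> set (word_data w)" for A l
      using M that by (auto simp: is_model_def)
    have step: "l + 1 \<in> M (state_atom (\<delta> a s))"
      if "s < m" "a < K" "l \<in> M (state_atom s)" "l \<in> M (letter_atom a)" for l a s
      using M that by (auto simp: is_model_def horn_query_def clause_true_def basic_concept_def)
    \<comment> \<open>In any model the clauses force the states of the run one after the
      other.\<close>
    have "t \<le> length w \<Longrightarrow> int t \<in> M (state_atom (run (take t w) 0))" for t
    proof (induction t)
      case 0
      then show ?case using data by (auto simp: word_data_iff)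
    next
      case (Suc t)
      then have "int t \<in> M (letter_atom (w ! t))"
        using data by (auto simp: word_data_iff)
      moreover have "run (take t w) 0 < m"
        using w m_gt_1 by (intro run_less) (auto dest: in_set_takeD)
      ultimately show ?case
        using Suc step[of "run (take t w) 0" "w ! t" "int t"] w
        by (auto simp: run_take_Suc add.commute)
    qed
    from this[of "length w"] acc show ?thesis by simp
  qed
  then show "int (length w) \<in> ans horn_query (set (word_data w))"
    by (simp add: ans_def tem_word_data horn_query_def)
qed

text \<open>In \<open>run_model\<close> the guess is correct everywhere, so only the accepting
  disjunct can hold. Conversely, a model refuting the query has no wrong step before the end, hence
  guesses the actual run and refutes acceptance of it.\<close>

lemma krom_query_ans:
  assumes w: "\<forall>a\<in>set w. a < K"
  shows "int (length w) \<in> ans krom_query (set (word_data w)) \<longleftrightarrow> run w 0 = 1"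
proof
  assume "int (length w) \<in> ans krom_query (set (word_data w))"
  moreover have "is_model (fst krom_query) (set (word_data w)) (run_model w)"
    using run_model_data
    by (auto simp: is_model_def krom_query_def guess_ontology_def clause_true_def
        basic_concept_def run_model_simps(2))
  ultimately have *: "int (length w) \<in> ext (run_model w) (snd krom_query)"
    by (auto simp: ans_def)
  have "l \<notin> ext (run_model w) (wrong_step (s, a))" if "a < K" for l s a
    using run_model_step[OF w that] by (auto simp: wrong_step_def run_model_simps(2))
  \<comment> \<open>Letters of the word and padding letters are at most \<open>2 * K\<close>, with
    \<open>K\<close> positive if the word has a letter. The end marker is placed at
    \<open>length w\<close>, which the strict past does not reach.\<close>
  moreover have "l \<notin> run_model w (letter_atom (3 * K))" if "l < int (length w)" for l
  proof -
    have "3 * K \<noteq> w ! t \<and> 3 * K \<noteq> 2 * K - w ! t" if "t < length w" for t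
      using w nth_mem[OF that] by fastforce
    with that show ?thesis by (auto simp: run_model_simps word_data_iff)
  qed
  ultimately show "run w 0 = 1"
    using * run_model_final[of w 1] by (auto simp: krom_query_def ext_foldr_Disj)
next
  assume acc: "run w 0 = 1"
  have "int (length w) \<in> ext M (snd krom_query)"
    if M: "is_model (fst krom_query) (set (word_data w)) M" for M
  proof (rule ccontr)
    assume not: "int (length w) \<notin> ext M (snd krom_query)"
    have data: "l \<in> M A" if "(A, l) \<in> set (word_data w)" for A l
      using M that by (auto simp: is_model_def)
    have guess: "l \<in> M (state_atom s) \<or> l \<in> M (costate_atom s)" if "s < m" for l s
      using M that
      by (auto simp: is_model_def krom_query_def guess_ontology_def clause_true_def
          basic_concept_def)
    \<comment> \<open>The query fails at \<open>length w\<close>, and \<open>DiaP\<close> ranges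
      over all earlier moments, so no wrong step starts there. Together with \<open>guess\<close>
      this leaves the state as the only choice.\<close>
    have step: "l + 1 \<notin> M (costate_atom (\<delta> a s))"
      if "s < m" "a < K" "l < int (length w)" "l \<in> M (state_atom s)" "l \<in> M (letter_atom a)"
      for l a s
      using not that by (force simp: krom_query_def ext_foldr_Disj wrong_step_def)
    have "t \<le> length w \<Longrightarrow> int t \<in> M (state_atom (run (take t w) 0))" for t
    proof (induction t)
      case 0
      then show ?case using data by (auto simp: word_data_iff)
    next
      case (Suc t)
      then have "int t \<in> M (letter_atom (w ! t))"
        using data by (auto simp: word_data_iff)
      moreover have less: "run (take t' w) 0 < m" for t'
        using w m_gt_1 by (intro run_less) (auto dest: in_set_takeD)
      ultimately show ?case
        using Suc step[of "run (take t w) 0" "w ! t" "int t"] w guess[OF less[of "Suc t"]]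
        by (auto simp: run_take_Suc add.commute)
    qed
    from this[of "length w"] acc not show False by (simp add: krom_query_def)
  qed
  then show "int (length w) \<in> ans krom_query (set (word_data w))"
    by (simp add: ans_def tem_word_data)
qed

text \<open>Each instruction reads at most one input bit. Nonemptiness ensures that the greatest
  timestamp of the resulting data is at least 1.\<close>

definition letter_program :: "nat \<Rightarrow> (bool list \<Rightarrow> nat) list \<Rightarrow> bool" where
  "letter_program n W \<longleftrightarrow> W \<noteq> [] \<and> (\<forall>h\<in>set W. projection n h \<and> (\<forall>x. h x < K))"

abbreviation letters :: "(bool list \<Rightarrow> nat) list \<Rightarrow> bool list \<Rightarrow> nat list" where
  "letters W x \<equiv> map (\<lambda>h. h x) W"

section \<open>Reduction from programs to query answering\<close>

lemma encode_word_data: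
  "encode (word_data w) (int (length w)) =
     (unary (length w) @ unary (state_atom 0) @ unary 0 @ unary (letter_atom K) @ unary (length w)) @
     concat (map (\<lambda>t. unary (letter_atom (w ! t)) @ unary t @
       unary (letter_atom (2 * K - w ! t)) @ unary t) [0..<length w])"
proof -
  have "concat (map f (concat (map (\<lambda>t. [p t, r t]) ts))) = concat (map (\<lambda>t. f (p t) @ f (r t)) ts)"
    for f :: "atom \<times> int \<Rightarrow> bool list" and p r :: "nat \<Rightarrow> atom \<times> int" and ts
    by (induction ts) auto
  then show ?thesis by (simp add: encode_def word_data_def)
qed

lemma projections_encode:
  assumes W: "letter_program n W"
  shows "projections n (\<lambda>x. encode (word_data (letters W x)) (int (length W)))"
proof -
  let ?g = "\<lambda>t a. unary (letter_atom a) @ unary t @ unary (letter_atom (2 * K - a)) @ unary t"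
  have "projections n (\<lambda>x. ?g t ((W ! t) x))" if "t < length W" for t
  \<comment> \<open>A letter \<open>a\<close> and its padding take \<open>3 * a + 3\<close> and
    \<open>6 * K - 3 * a + 3\<close> bits, the two copies of \<open>t\<close> take
    \<open>t + 1\<close> bits each; \<open>a\<close> cancels.\<close>
  proof (rule projections_comp[where h = "W ! t" and g = "?g t" and l = "6 * K + 2 * t + 8"])
    have *: "projection n (W ! t)" "(W ! t) x < K" for x
      using W nth_mem[OF that] by (auto simp: letter_program_def)
    show "projection n (W ! t)" by fact
    show "length (?g t ((W ! t) x)) = 6 * K + 2 * t + 8" for x
      using *(2)[of x] by (simp add: letter_atom_def)
  qed
  then have "projections n (\<lambda>x. concat (map (\<lambda>t. ?g t ((W ! t) x)) [0..<length W]))"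
    by (intro projections_concat) simp
  from projections_append[OF projections_const this]
  have "projections n (\<lambda>x. (unary (length W) @ unary (state_atom 0) @ unary 0 @
      unary (letter_atom K) @ unary (length W)) @
      concat (map (\<lambda>t. ?g t ((W ! t) x)) [0..<length W]))" .
  moreover have "map (\<lambda>t. ?g t (letters W x ! t)) [0..<length W] =
      map (\<lambda>t. ?g t ((W ! t) x)) [0..<length W]" for x
    by simp
  then have "encode (word_data (letters W x)) (int (length W)) =
      (unary (length W) @ unary (state_atom 0) @ unary 0 @ unary (letter_atom K) @
        unary (length W)) @ concat (map (\<lambda>t. ?g t ((W ! t) x)) [0..<length W])" for x
    using encode_word_data[of "letters W x"] by (simp only: length_map)
  ultimately show ?thesis
    by (simp only:)
qed

text \<open>The bound is quadratic because each of the linearly many timestamps is written in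
  unary.\<close>

lemma length_encode:
  assumes w: "\<forall>a\<in>set w. a < K"
  shows "length (encode (word_data w) (int (length w))) \<le> (6 * K + 12) * (length w + 1)^2"
proof -
  let ?L = "length w"
  have "length (concat (map (\<lambda>t. unary (letter_atom (w ! t)) @ unary t @
      unary (letter_atom (2 * K - w ! t)) @ unary t) [0..<?L])) =
      (\<Sum>t<?L. 3 * (w ! t) + 3 * (2 * K - w ! t) + 2 * t + 8)"
    by (auto simp: length_concat o_def interv_sum_list_conv_sum_set_nat letter_atom_def
        atLeast0LessThan intro!: sum.cong)
  also have "\<dots> \<le> (\<Sum>t<?L. 6 * K + 2 * ?L + 8)"
  proof (rule sum_mono)
    fix t assume t: "t \<in> {..<?L}"
    then have "w ! t < K" using w by simp
    with t show "3 * (w ! t) + 3 * (2 * K - w ! t) + 2 * t + 8 \<le> 6 * K + 2 * ?L + 8"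
      by simp
  qed
  also have "\<dots> = ?L * (6 * K + 2 * ?L + 8)"
    by simp
  finally have "length (encode (word_data w) (int ?L)) \<le>
      2 * ?L + 3 * K + 7 + ?L * (6 * K + 2 * ?L + 8)"
    by (simp add: encode_word_data state_atom_def letter_atom_def)
  also have "\<dots> \<le> (6 * K + 12) * (?L + 1)^2"
    by (simp add: power2_eq_square algebra_simps)
  finally show ?thesis .
qed

text \<open>The length is bounded only from \<open>N\<close> on: programs are nonempty, while
  \<open>n ^ k\<close> may vanish at \<open>n = 0\<close>, and the depth of circuits is bounded only
  asymptotically.\<close>

definition decides_by_programs :: "bool list set \<Rightarrow> bool" where
  "decides_by_programs L \<longleftrightarrow> (\<exists>W k N. \<forall>n. letter_program n (W n) \<and>
     (N \<le> n \<longrightarrow> length (W n) \<le> n ^ k) \<and>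
     (\<forall>x. length x = n \<longrightarrow> (x \<in> L \<longleftrightarrow> run (letters (W n) x) 0 = 1)))"

lemma AC0_reducible_answering_problem:
  assumes q: "\<And>w. \<forall>a\<in>set w. a < K \<Longrightarrow>
      int (length w) \<in> ans q (set (word_data w)) \<longleftrightarrow> run w 0 = 1"
    and "decides_by_programs L"
  shows "AC0_reducible L (answering_problem q)"
proof -
  obtain W k N where prog: "\<And>n. letter_program n (W n)"
    and len: "\<And>n. N \<le> n \<Longrightarrow> length (W n) \<le> n ^ k"
    and dec: "\<And>x. x \<in> L \<longleftrightarrow> run (letters (W (length x)) x) 0 = 1"
    using assms(2) unfolding decides_by_programs_def by metis
  define F where "F n x = encode (word_data (letters (W n) x)) (int (length (W n)))" for n x
  have letters: "\<forall>a\<in>set (letters (W n) x). a < K" for n x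
    using prog[of n] by (auto simp: letter_program_def)
  have "AC0_computable (\<lambda>x. F (length x) x)"
  proof (rule AC0_computable_projections[where F = F and N = "max N 1"])
    show "projections n (F n)" for n
      unfolding F_def by (rule projections_encode[OF prog])
    fix n x assume n: "max N 1 \<le> n"
    have "length (F n x) \<le> (6 * K + 12) * (length (W n) + 1)^2"
      using length_encode[OF letters, of x n] by (simp add: F_def)
    \<comment> \<open>Here \<open>1 \<le> n ^ k\<close> since \<open>n\<close> is positive.\<close>
    also have "\<dots> \<le> (6 * K + 12) * (n ^ k + n ^ k)^2"
      using n len[of n] by (intro mult_le_mono le_refl power_mono add_mono) auto
    also have "\<dots> = (6 * K + 12) * 4 * n ^ (2 * k)"
      unfolding power_even_eq by (simp add: power2_eq_square algebra_simps)
    finally show "length (F n x) \<le> (6 * K + 12) * 4 * n ^ (2 * k)" .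
  qed simp
  moreover have "x \<in> L \<longleftrightarrow> F (length x) x \<in> answering_problem q" for x
  proof -
    let ?w = "letters (W (length x)) x"
    have "F (length x) x \<in> answering_problem q \<longleftrightarrow>
        int (length ?w) \<in> ans q (set (word_data ?w))"
      unfolding F_def using prog[of "length x"] encode_in_answering_problem[of "word_data ?w" _ q]
      by (simp add: letter_program_def is_data_word_data tem_word_data)
    with dec q[OF letters] show ?thesis by blast
  qed
  ultimately show ?thesis
    unfolding AC0_reducible_def by blast
qed

end

section \<open>Branching programs over a set of commutators\<close>

text \<open>Letters act as permutations, and \<open>a\<close> acts as the commutator of
  \<open>lc a\<close> and \<open>rc a\<close>. Requiring this of every letter lets the construction
  be iterated without conjugating cycles into each other.\<close>

locale commutator_automaton = automaton +
  fixes inv lc rc :: "nat \<Rightarrow> nat"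
  assumes K_gt_1: "1 < K"
    and letters_less: "a < K \<Longrightarrow> inv a < K" "a < K \<Longrightarrow> lc a < K" "a < K \<Longrightarrow> rc a < K"
    and \<delta>_id: "s < m \<Longrightarrow> \<delta> 0 s = s"
    and \<delta>_inv: "a < K \<Longrightarrow> s < m \<Longrightarrow> \<delta> (inv a) (\<delta> a s) = s" "a < K \<Longrightarrow> s < m \<Longrightarrow> \<delta> a (\<delta> (inv a) s) = s"
    and \<delta>_commutator: "a < K \<Longrightarrow> s < m \<Longrightarrow>
      \<delta> (inv (rc a)) (\<delta> (inv (lc a)) (\<delta> (rc a) (\<delta> (lc a) s))) = \<delta> a s"
    and \<delta>_accept: "\<delta> 1 0 = 1"
begin

text \<open>All letters \<open>a\<close> are treated at once, because the programs for a negation or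
  conjunction with target \<open>a\<close> use programs of the arguments for other letters.\<close>

definition computes :: "nat \<Rightarrow> nat \<Rightarrow> (bool list \<Rightarrow> bool) \<Rightarrow> bool" where
  "computes n N \<phi> \<longleftrightarrow> (\<forall>a<K. \<exists>W. letter_program n W \<and> length W \<le> N \<and>
     (\<forall>x s. length x = n \<longrightarrow> s < m \<longrightarrow> run (letters W x) s = (if \<phi> x then \<delta> a s else s)))"

lemma computesE:
  assumes "computes n N \<phi>" "a < K"
  obtains W where "letter_program n W" "length W \<le> N"
    "\<And>x s. length x = n \<Longrightarrow> s < m \<Longrightarrow> run (letters W x) s = (if \<phi> x then \<delta> a s else s)"
  using assms unfolding computes_def by blast

lemma computes_mono:
  assumes "computes n N \<phi>" "N \<le> N'"
  shows "computes n N' \<phi>"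
  using assms unfolding computes_def by (meson le_trans)

lemma computes_cong:
  assumes "computes n N \<phi>" "\<And>x. length x = n \<Longrightarrow> \<phi> x = \<psi> x"
  shows "computes n N \<psi>"
  using assms unfolding computes_def by metis

lemma computes_projection:
  assumes "projection n \<phi>"
  shows "computes n 1 \<phi>"
  unfolding computes_def
proof (intro allI impI)
  fix a assume "a < K"
  then show "\<exists>W. letter_program n W \<and> length W \<le> 1 \<and> (\<forall>x s. length x = n \<longrightarrow> s < m \<longrightarrow>
      run (letters W x) s = (if \<phi> x then \<delta> a s else s))"
    using projection_comp[OF assms, where g = "\<lambda>b. if b then a else 0"] K_gt_1 \<delta>_id
    by (intro exI[of _ "[\<lambda>x. if \<phi> x then a else 0]"]) (auto simp: letter_program_def)
qed

text \<open>A program for \<open>inv a\<close> is followed by an unconditional \<open>a\<close>: the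
  two cancel if the gate is true, and \<open>a\<close> remains otherwise.\<close>

lemma computes_not:
  assumes "computes n N \<phi>"
  shows "computes n (N + 1) (\<lambda>x. \<not> \<phi> x)"
  unfolding computes_def
proof (intro allI impI)
  fix a assume a: "a < K"
  obtain W where W: "letter_program n W" "length W \<le> N"
    "\<And>x s. length x = n \<Longrightarrow> s < m \<Longrightarrow> run (letters W x) s = (if \<phi> x then \<delta> (inv a) s else s)"
    using computesE[OF assms letters_less(1)[OF a]] by blast
  show "\<exists>W. letter_program n W \<and> length W \<le> N + 1 \<and> (\<forall>x s. length x = n \<longrightarrow> s < m \<longrightarrow>
      run (letters W x) s = (if \<not> \<phi> x then \<delta> a s else s))"
    using a W by (intro exI[of _ "W @ [\<lambda>_. a]"])
      (auto simp: letter_program_def projection_const \<delta>_inv)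
qed

text \<open>If one argument is false, its two blocks act as the identity and the other two cancel;
  if both are true, the commutator remains, which acts as \<open>a\<close>.\<close>

lemma computes_and:
  assumes \<phi>: "computes n N \<phi>" and \<psi>: "computes n N \<psi>"
  shows "computes n (4 * N) (\<lambda>x. \<phi> x \<and> \<psi> x)"
  unfolding computes_def
proof (intro allI impI)
  fix a assume a: "a < K"
  obtain U where U: "letter_program n U" "length U \<le> N"
    "\<And>x s. length x = n \<Longrightarrow> s < m \<Longrightarrow> run (letters U x) s = (if \<phi> x then \<delta> (lc a) s else s)"
    using computesE[OF \<phi> letters_less(2)[OF a]] by blast
  obtain V where V: "letter_program n V" "length V \<le> N"
    "\<And>x s. length x = n \<Longrightarrow> s < m \<Longrightarrow> run (letters V x) s = (if \<psi> x then \<delta> (rc a) s else s)"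
    using computesE[OF \<psi> letters_less(3)[OF a]] by blast
  obtain U' where U': "letter_program n U'" "length U' \<le> N"
    "\<And>x s. length x = n \<Longrightarrow> s < m \<Longrightarrow> run (letters U' x) s = (if \<phi> x then \<delta> (inv (lc a)) s else s)"
    using computesE[OF \<phi> letters_less(1)[OF letters_less(2)[OF a]]] by blast
  obtain V' where V': "letter_program n V'" "length V' \<le> N"
    "\<And>x s. length x = n \<Longrightarrow> s < m \<Longrightarrow> run (letters V' x) s = (if \<psi> x then \<delta> (inv (rc a)) s else s)"
    using computesE[OF \<psi> letters_less(1)[OF letters_less(3)[OF a]]] by blast
  show "\<exists>W. letter_program n W \<and> length W \<le> 4 * N \<and> (\<forall>x s. length x = n \<longrightarrow> s < m \<longrightarrow>
      run (letters W x) s = (if \<phi> x \<and> \<psi> x then \<delta> a s else s))"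
  proof (intro exI[of _ "U @ V @ U' @ V'"] conjI allI impI)
    show "letter_program n (U @ V @ U' @ V')"
      using U(1) V(1) U'(1) V'(1) by (auto simp: letter_program_def)
    show "length (U @ V @ U' @ V') \<le> 4 * N"
      using U(2) V(2) U'(2) V'(2) by simp
    fix x :: "bool list" and s
    assume "length x = n" "s < m"
    then show "run (letters (U @ V @ U' @ V') x) s = (if \<phi> x \<and> \<psi> x then \<delta> a s else s)"
      using a U(3) V(3) U'(3) V'(3) by (auto simp: letters_less \<delta>_less \<delta>_inv \<delta>_commutator)
  qed
qed

lemma computes_or:
  assumes "computes n N \<phi>" "computes n N \<psi>"
  shows "computes n (4 * N + 5) (\<lambda>x. \<phi> x \<or> \<psi> x)"
proof -
  have "computes n (4 * (N + 1) + 1) (\<lambda>x. \<not> (\<not> \<phi> x \<and> \<not> \<psi> x))"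
    using assms by (intro computes_not computes_and)
  then show ?thesis by (simp add: algebra_simps)
qed

text \<open>Induction along the circuit, where the length grows at most ninefold per level. Shared
  gates are expanded anew at each use, so depth and not size governs the length.\<close>

lemma computes_gate:
  assumes wf: "wf_circuit n C" and fanin: "bounded_fanin C" and "k < length (gates C)"
  shows "computes n (9 ^ (gate_depths C ! k)) (\<lambda>x. gate_values x C ! k)"
  using assms(3)
proof (induction k rule: less_induct)
  case (less k)
  let ?g = "gates C ! k" and ?v = "\<lambda>j x. gate_values x C ! j" and ?d = "\<lambda>j. gate_depths C ! j"
  have val: "?v k x = gate_value x (gate_values x C) ?g" for x
    by (rule gate_values_nth[OF wf less.prems])
  have depth: "?d k = gate_depth (gate_depths C) ?g"
    by (rule gate_depths_nth[OF wf less.prems])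
  \<comment> \<open>Any \<open>d\<close> above the depth of the argument is allowed, so that two
    arguments can share one bound.\<close>
  have IH: "computes n (9 ^ d) (?v j)" if "j \<in> set (args ?g)" "?d j \<le> d" for j d
  proof -
    have "j < k" using wf that less.prems by (auto simp: wf_circuit_def)
    then have "computes n (9 ^ ?d j) (?v j)" using less by simp
    then show ?thesis by (rule computes_mono) (use that in \<open>simp add: power_increasing\<close>)
  qed
  have const: "computes n (9 ^ d) (\<lambda>_. c)" for d c
    by (rule computes_mono[OF computes_projection[OF projection_const]]) simp
  \<comment> \<open>A disjunction is the most expensive gate; its constant 5 is at most
    \<open>5 * 9 ^ d\<close>, which explains the base \<open>9 = 4 + 5\<close>.\<close>
  have up: "computes n (9 ^ Suc d) \<phi>" if "computes n N \<phi>" "N \<le> 4 * 9 ^ d + 5" for d \<phi> N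
  proof (rule computes_mono[OF that(1)])
    have "(1::nat) \<le> 9 ^ d" by simp
    with that(2) show "N \<le> 9 ^ Suc d" unfolding power_Suc by linarith
  qed
  have short: "js = [] \<or> (\<exists>i. js = [i]) \<or> (\<exists>i j. js = [i, j])" if "length js \<le> 2" for js :: "nat list"
    using that by (cases js; cases "tl js") auto
  have two: "length (args ?g) \<le> 2"
    using fanin less.prems by (simp add: bounded_fanin_def)
  show ?case
  proof (cases ?g)
    case (Input i)
    then have "i < n"
      using wf less.prems by (metis nth_mem wf_circuit_def)
    then have "projection n (\<lambda>x. x ! i)"
      unfolding projection_def by (intro disjI2 exI[of _ i] conjI exI[of _ True] exI[of _ False]) auto
    from computes_projection[OF this] show ?thesis by (simp add: val depth Input)
  next
    case (NotG j)
    then have "computes n (9 ^ ?d j + 1) (\<lambda>x. \<not> ?v j x)"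
      by (intro computes_not IH) auto
    then have "computes n (9 ^ Suc (?d j)) (\<lambda>x. \<not> ?v j x)"
      by (rule up) simp
    then show ?thesis by (simp add: val depth NotG)
  next
    case (AndG js)
    define d where "d = Max (insert 0 (?d ` set js))"
    have j: "computes n (9 ^ d) (?v j)" if "j \<in> set js" for j
      using that by (intro IH) (auto simp: AndG d_def)
    have "computes n (9 ^ Suc d) (\<lambda>x. \<forall>j\<in>set js. ?v j x)"
      using short[OF two[unfolded AndG args.simps]]
    proof (elim disjE exE)
      fix i assume "js = [i]"
      then show ?thesis using up[OF j[of i]] by simp
    next
      fix i i' assume "js = [i, i']"
      then show ?thesis using up[OF computes_and[OF j[of i] j[of i']]] by simp
    qed (auto simp: AndG const simp del: power_Suc)
    then show ?thesis by (simp add: val depth AndG d_def)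
  next
    case (OrG js)
    define d where "d = Max (insert 0 (?d ` set js))"
    have j: "computes n (9 ^ d) (?v j)" if "j \<in> set js" for j
      using that by (intro IH) (auto simp: OrG d_def)
    have "computes n (9 ^ Suc d) (\<lambda>x. \<exists>j\<in>set js. ?v j x)"
      using short[OF two[unfolded OrG args.simps]]
    proof (elim disjE exE)
      fix i assume "js = [i]"
      then show ?thesis using up[OF j[of i]] by simp
    next
      fix i i' assume "js = [i, i']"
      then show ?thesis using up[OF computes_or[OF j[of i] j[of i']]] by simp
    qed (auto simp: OrG const simp del: power_Suc)
    then show ?thesis by (simp add: val depth OrG d_def)
  qed
qed

lemma NC1_decides_by_programs:
  assumes "L \<in> NC1"
  shows "decides_by_programs L"
proof -
  obtain C where wf: "\<And>n. wf_circuit n (C n)" and fanin: "\<And>n. bounded_fanin (C n)"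
    and depth: "(\<lambda>n. real (circuit_depth (C n))) \<in> O(\<lambda>n. log 2 (real n))"
    and eval: "\<And>x. circuit_eval (C (length x)) x = [x \<in> L]"
    using assms unfolding NC1_def by blast
  obtain c where "eventually (\<lambda>n. norm (real (circuit_depth (C n))) \<le> c * norm (log 2 (real n))) at_top"
    using depth by (auto elim: landau_o.bigE)
  then obtain N where N: "\<And>n. N \<le> n \<Longrightarrow> norm (real (circuit_depth (C n))) \<le> c * norm (log 2 (real n))"
    unfolding eventually_sequentially by blast
  \<comment> \<open>The factor 4 comes from \<open>9 \<le> 2 ^ 4\<close>, which turns logarithmic
    depth into polynomial length; \<open>nat\<close> replaces a negative constant by 0.\<close>
  define k where "k = 4 * nat \<lceil>c\<rceil>"
  have poly: "9 ^ circuit_depth (C n) \<le> n ^ k" if n: "max N 1 \<le> n" for n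
  proof -
    have "0 \<le> log 2 (real n)" using n by simp
    then have "real (circuit_depth (C n)) \<le> c * log 2 (real n)"
      using N[of n] n by simp
    also have "\<dots> \<le> real (nat \<lceil>c\<rceil>) * log 2 (real n)"
      using \<open>0 \<le> log 2 (real n)\<close> by (intro mult_right_mono real_nat_ceiling_ge)
    finally have "4 * real (circuit_depth (C n)) \<le> log 2 (real n ^ k)"
      using n by (simp add: k_def log_nat_power)
    moreover have "0 < real n ^ k" using n by simp
    ultimately have "2 powr (4 * real (circuit_depth (C n))) \<le> real n ^ k"
      by (simp add: le_log_iff)
    moreover have "(9::real) ^ circuit_depth (C n) \<le> 16 ^ circuit_depth (C n)"
      by (rule power_mono) auto
    moreover have "(16::real) ^ circuit_depth (C n) = 2 powr (4 * real (circuit_depth (C n)))"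
      by (simp add: powr_powr[symmetric] powr_realpow)
    ultimately have "real (9 ^ circuit_depth (C n)) \<le> real (n ^ k)"
      by simp
    then show ?thesis by (simp only: of_nat_le_iff)
  qed
  have "\<exists>W. letter_program n W \<and> length W \<le> 9 ^ circuit_depth (C n) \<and>
      (\<forall>x. length x = n \<longrightarrow> (x \<in> L \<longleftrightarrow> run (letters W x) 0 = 1))" for n
  proof -
    \<comment> \<open>Evaluating on any single string of length \<open>n\<close> reveals the number
      of outputs.\<close>
    have "length (outputs (C n)) = 1"
      using eval[of "replicate n True"] by (auto simp: circuit_eval_def dest: arg_cong[where f = length])
    then obtain j where j: "outputs (C n) = [j]"
      by (auto simp: length_Suc_conv)
    then have "j < length (gates (C n))"
      using wf[of n] by (simp add: wf_circuit_def)
    then have "computes n (9 ^ (gate_depths (C n) ! j)) (\<lambda>x. gate_values x (C n) ! j)"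
      using wf fanin by (intro computes_gate)
    moreover have "gate_depths (C n) ! j \<le> circuit_depth (C n)"
      unfolding circuit_depth_def using \<open>j < length (gates (C n))\<close>
      by (intro Max_ge) (auto simp: length_gate_depths)
    ultimately have "computes n (9 ^ circuit_depth (C n)) (\<lambda>x. gate_values x (C n) ! j)"
      by (rule computes_mono[OF _ power_increasing]) auto
    moreover have "gate_values x (C n) ! j \<longleftrightarrow> x \<in> L" if "length x = n" for x
      using eval[of x] that j by (simp add: circuit_eval_def)
    ultimately have "computes n (9 ^ circuit_depth (C n)) (\<lambda>x. x \<in> L)"
      by (rule computes_cong)
    \<comment> \<open>Letter 1 takes the initial state 0 to the accepting state 1; if
      \<open>x\<close> is not in \<open>L\<close>, the run ends in 0.\<close>
    then obtain W where "letter_program n W" "length W \<le> 9 ^ circuit_depth (C n)"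
      "\<And>x s. length x = n \<Longrightarrow> s < m \<Longrightarrow> run (letters W x) s = (if x \<in> L then \<delta> 1 s else s)"
      using computesE[OF _ K_gt_1] by blast
    then show ?thesis
      using m_gt_1 \<delta>_accept by (intro exI[of _ W]) auto
  qed
  then obtain W where "\<And>n. letter_program n (W n)" "\<And>n. length (W n) \<le> 9 ^ circuit_depth (C n)"
      "\<And>n x. length x = n \<Longrightarrow> (x \<in> L \<longleftrightarrow> run (letters (W n) x) 0 = 1)"
    by metis
  with poly show ?thesis
    unfolding decides_by_programs_def
    by (intro exI[of _ W] exI[of _ k] exI[of _ "max N 1"]) (meson le_trans)
qed

theorem NC1_hard_queries:
  "NC1_hard (answering_problem horn_query)" "NC1_hard (answering_problem krom_query)"
  unfolding NC1_hard_def
  by (auto intro!: AC0_reducible_answering_problem NC1_decides_by_programs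
      horn_query_ans krom_query_ans)

end

text \<open>The identity and three 5-cycles of \<open>{0, \<dots>, 4}\<close> with their inverses. Each of the
  six 5-cycles is a commutator of two others.\<close>

definition perms :: "nat list list" where
  "perms = [[0, 1, 2, 3, 4], [1, 2, 3, 4, 0], [4, 0, 1, 2, 3], [1, 3, 0, 4, 2], [2, 0, 4, 1, 3],
     [1, 4, 3, 0, 2], [3, 0, 4, 2, 1]]"

text \<open>The lists tabulate \<open>inv\<close>, \<open>lc\<close> and \<open>rc\<close>. Letters
  1 and 2, 3 and 4, 5 and 6 are mutually inverse, and the identity is its own commutator. All laws
  are checked on the 7 letters and 5 points.\<close>

interpretation five_cycles: commutator_automaton 5 7 "\<lambda>a s. perms ! a ! s"
  "(!) [0, 2, 1, 4, 3, 6, 5]" "(!) [0, 4, 5, 6, 1, 2, 3]" "(!) [0, 5, 4, 1, 6, 3, 2]"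
proof
  fix a s :: nat
  assume "a < 7" "s < 5"
  then have "a \<in> {0, 1, 2, 3, 4, 5, 6}" "s \<in> {0, 1, 2, 3, 4}" by auto
  then show "perms ! a ! s < 5"
    "perms ! ([0, 2, 1, 4, 3, 6, 5] ! a) ! (perms ! a ! s) = s"
    "perms ! a ! (perms ! ([0, 2, 1, 4, 3, 6, 5] ! a) ! s) = s"
    "perms ! ([0, 2, 1, 4, 3, 6, 5] ! ([0, 5, 4, 1, 6, 3, 2] ! a)) !
      (perms ! ([0, 2, 1, 4, 3, 6, 5] ! ([0, 4, 5, 6, 1, 2, 3] ! a)) !
        (perms ! ([0, 5, 4, 1, 6, 3, 2] ! a) ! (perms ! ([0, 4, 5, 6, 1, 2, 3] ! a) ! s))) =
      perms ! a ! s"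
    by (auto simp: perms_def)
next
  fix a :: nat
  assume "a < 7"
  then have "a \<in> {0, 1, 2, 3, 4, 5, 6}" by auto
  then show "[0, 2, 1, 4, 3, 6, 5] ! a < (7::nat)" "[0, 4, 5, 6, 1, 2, 3] ! a < (7::nat)"
    "[0, 5, 4, 1, 6, 3, 2] ! a < (7::nat)"
    by auto
next
  fix s :: nat
  assume "s < 5"
  then have "s \<in> {0, 1, 2, 3, 4}" by auto
  then show "perms ! 0 ! s = s"
    by (auto simp: perms_def)
qed (auto simp: perms_def)

theorem theorem10:
  shows "(\<exists>q. is_OMAQ Next Horn q \<and> NC1_hard (answering_problem q)) \<and>
         (\<exists>q. is_OMPIQ Box Krom q \<and> NC1_hard (answering_problem q)) \<and>
         (\<exists>q. is_OMPIQ Next Krom q \<and> NC1_hard (answering_problem q))"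
  by (intro conjI exI)
    (rule five_cycles.is_OMAQ_horn_query five_cycles.is_OMPIQ_krom_query five_cycles.NC1_hard_queries)+

end
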